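(* There are absolute constants $C_1,C_2>0$ such that the following hold. (1) For every principal-agent problem $(\mathbf c,\mathbf F,\mathbf r)$ with $n\ge1$ actions, $T\ge2$ types, and any number of outcomes, $$\mathrm{OptLinear}(\mathbf c,\mathbf F,\mathbf r)\ \ge\ \frac{C_1}{n\log T}\,\mathrm{Welfare}(\mathbf c,\mathbf F,\mathbf r).$$ (2) For all $n\ge2$ and $T\ge2$ there exists a principal-agent problem $(\mathbf c,\mathbf F,\mathbf r)$ with $n$ actions and $T$ types and $\mathrm{Welfare}(\mathbf c,\mathbf F,\mathbf r)>0$ such that $$\mathrm{OptLinear}(\mathbf c,\mathbf F,\mathbf r)\ \le\ \frac{C_2}{n\log T}\,\mathrm{Welfare}(\mathbf c,\mathbf F,\mathbf r).$$
   Context: A (typed) principal-agent problem $(\mathbf c,\mathbf F,\mathbf r)$ with $n$ actions, $m$ outcomes and $T$ types consists of: costs $\mathbf c\in\mathbb R_{\ge 0}^n$ (the same for all types) with $0=c_1\le c_2\le\dots\le c_n$; rewards $\mathbf r\in\mathbb R_{\ge0}^m$ with $0=r_1\le\dots\le r_m$; and, for each type $t\in[T]$ and action $i\in[n]$, a probability distribution $(F^{(t)}_{i,j})_{j\in[m]}$ over outcomes. The agent's type is uniform on $[T]$; $\mathbb E_t$ denotes the expectation over it. Let $R^{(t)}_i=\sum_jF^{(t)}_{i,j}r_j$. A contract is a vector $\mathbf x\in\mathbb R_{\ge0}^m$. Under $\mathbf x$, an agent of type $t$ plays an action $i_*^{(t)}(\mathbf x)\in\arg\max_i\big(\sum_j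 F^{(t)}_{i,j}x_j-c_i\big)$, ties being broken so as to maximize the principal's profit $\mathrm{Profit}^{(t)}(\mathbf x)=\sum_j F^{(t)}_{i_*^{(t)}(\mathbf x),j}(r_j-x_j)$. $\mathrm{Welfare}=\mathbb E_t[\max_i(R^{(t)}_i-c_i)]$ and $\mathrm{OptLinear}=\max_{\alpha\in[0,1]}\mathbb E_t[\mathrm{Profit}^{(t)}(\alpha\mathbf r)]$ (best linear contract $\mathbf x=\alpha\mathbf r$). *)

theory Defs
  imports "HOL-Analysis.Analysis"
begin

text \<open>
  Actions, outcomes and types are indexed from 1, by \<open>{1..n}\<close>, \<open>{1..m}\<close> and \<open>{1..T}\<close>;
  values of the components outside these ranges are irrelevant.
  \<open>outcome_prob P t i j\<close> is the probability of outcome \<open>j\<close> when an agent of type \<open>t\<close>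
  plays action \<open>i\<close>.
\<close>

record pa_problem =
  n_actions :: nat
  n_outcomes :: nat
  n_types :: nat
  cost :: "nat \<Rightarrow> real"
  outcome_prob :: "nat \<Rightarrow> nat \<Rightarrow> nat \<Rightarrow> real"
  reward :: "nat \<Rightarrow> real"

abbreviation actions :: "pa_problem \<Rightarrow> nat set" where
  "actions P \<equiv> {1..n_actions P}"

abbreviation outcomes :: "pa_problem \<Rightarrow> nat set" where
  "outcomes P \<equiv> {1..n_outcomes P}"

abbreviation types :: "pa_problem \<Rightarrow> nat set" where
  "types P \<equiv> {1..n_types P}"

definition principal_agent :: "pa_problem \<Rightarrow> bool" where
  "principal_agent P \<longleftrightarrow>
     n_actions P \<ge> 1 \<and> n_outcomes P \<ge> 1 \<and> n_types P \<ge> 1 \<and>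
     (\<forall>i\<in>actions P. cost P i \<ge> 0) \<and> cost P 1 = 0 \<and> mono_on (actions P) (cost P) \<and>
     (\<forall>j\<in>outcomes P. reward P j \<ge> 0) \<and> reward P 1 = 0 \<and> mono_on (outcomes P) (reward P) \<and>
     (\<forall>t\<in>types P. \<forall>i\<in>actions P.
        (\<forall>j\<in>outcomes P. outcome_prob P t i j \<ge> 0) \<and>
        (\<Sum>j\<in>outcomes P. outcome_prob P t i j) = 1)"

definition expect_type :: "pa_problem \<Rightarrow> (nat \<Rightarrow> real) \<Rightarrow> real" where
  "expect_type P f = (\<Sum>t\<in>types P. f t) / real (n_types P)"

definition expected_reward :: "pa_problem \<Rightarrow> nat \<Rightarrow> nat \<Rightarrow> real" where
  "expected_reward P t i = (\<Sum>j\<in>outcomes P. outcome_prob P t i j * reward P j)"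

definition agent_utility :: "pa_problem \<Rightarrow> nat \<Rightarrow> (nat \<Rightarrow> real) \<Rightarrow> nat \<Rightarrow> real" where
  "agent_utility P t x i = (\<Sum>j\<in>outcomes P. outcome_prob P t i j * x j) - cost P i"

definition best_responses :: "pa_problem \<Rightarrow> nat \<Rightarrow> (nat \<Rightarrow> real) \<Rightarrow> nat set" where
  "best_responses P t x = {i. is_arg_max (agent_utility P t x) (\<lambda>i. i \<in> actions P) i}"

definition action_profit :: "pa_problem \<Rightarrow> nat \<Rightarrow> (nat \<Rightarrow> real) \<Rightarrow> nat \<Rightarrow> real" where
  "action_profit P t x i = (\<Sum>j\<in>outcomes P. outcome_prob P t i j * (reward P j - x j))"

definition chosen_action :: "pa_problem \<Rightarrow> nat \<Rightarrow> (nat \<Rightarrow> real) \<Rightarrow> nat" where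
  "chosen_action P t x = arg_max_on (action_profit P t x) (best_responses P t x)"

definition profit :: "pa_problem \<Rightarrow> nat \<Rightarrow> (nat \<Rightarrow> real) \<Rightarrow> real" where
  "profit P t x = action_profit P t x (chosen_action P t x)"

definition welfare :: "pa_problem \<Rightarrow> real" where
  "welfare P = expect_type P (\<lambda>t. MAX i\<in>actions P. expected_reward P t i - cost P i)"

definition linear_contract :: "pa_problem \<Rightarrow> real \<Rightarrow> nat \<Rightarrow> real" where
  "linear_contract P \<alpha> j = \<alpha> * reward P j"

definition linear_profit :: "pa_problem \<Rightarrow> real \<Rightarrow> real" where
  "linear_profit P \<alpha> = expect_type P (\<lambda>t. profit P t (linear_contract P \<alpha>))"

text \<open>The supremum is a maximum; see \<open>opt_linear_attained\<close> below.\<close>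

definition opt_linear :: "pa_problem \<Rightarrow> real" where
  "opt_linear P = (SUP \<alpha>\<in>{0..1}. linear_profit P \<alpha>)"

lemma finite_has_arg_max:
  fixes f :: "'a \<Rightarrow> real"
  assumes "finite S" "S \<noteq> {}"
  shows "\<exists>x. is_arg_max f (\<lambda>x. x \<in> S) x"
proof -
  have "Max (f ` S) \<in> f ` S" using assms by simp
  then obtain x where x: "x \<in> S" "f x = Max (f ` S)" by (metis imageE)
  have "f y \<le> f x" if "y \<in> S" for y using x that assms by simp
  with x(1) show ?thesis unfolding is_arg_max_linorder by blast
qed

lemma finite_best_responses: "finite (best_responses P t x)"
  by (rule finite_subset[of _ "actions P"]) (auto simp: best_responses_def is_arg_max_def)

lemma best_responses_nonempty:
  assumes "principal_agent P"
  shows "best_responses P t x \<noteq> {}"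
  using finite_has_arg_max[of "actions P" "agent_utility P t x"] assms
  by (auto simp: best_responses_def principal_agent_def)

lemma chosen_action_best_response:
  assumes "principal_agent P"
  shows "chosen_action P t x \<in> best_responses P t x"
    and "i \<in> best_responses P t x \<Longrightarrow> action_profit P t x i \<le> profit P t x"
proof -
  let ?Q = "\<lambda>i. i \<in> best_responses P t x"
  have "\<exists>i. is_arg_max (action_profit P t x) ?Q i"
    using finite_has_arg_max finite_best_responses best_responses_nonempty[OF assms] by metis
  then have "is_arg_max (action_profit P t x) ?Q (chosen_action P t x)"
    unfolding chosen_action_def arg_max_on_def arg_max_def by (rule someI_ex)
  then show "chosen_action P t x \<in> best_responses P t x"
    and "i \<in> best_responses P t x \<Longrightarrow> action_profit P t x i \<le> profit P t x"
    by (auto simp: is_arg_max_linorder profit_def)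
qed

lemma opt_linear_attained:
  assumes P: "principal_agent P"
  shows "\<exists>\<alpha>\<in>{0..1}. linear_profit P \<alpha> = opt_linear P \<and>
           (\<forall>\<beta>\<in>{0..1}. linear_profit P \<beta> \<le> linear_profit P \<alpha>)"
proof -
  define x where "x = linear_contract P"
  define A where "A \<sigma> = {\<alpha>\<in>{0..1}. \<forall>t\<in>types P. \<sigma> t \<in> best_responses P t (x \<alpha>)}" for \<sigma>
  define g where "g \<sigma> \<alpha> = expect_type P (\<lambda>t. action_profit P t (x \<alpha>) (\<sigma> t))" for \<sigma> \<alpha>
  define S where "S = {\<sigma> \<in> types P \<rightarrow>\<^sub>E actions P. A \<sigma> \<noteq> {}}"
  define \<tau> where "\<tau> \<alpha> = (\<lambda>t\<in>types P. chosen_action P t (x \<alpha>))" for \<alpha>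
  have finS: "finite S" unfolding S_def by (intro finite_Collect_conjI disjI1) (simp add: finite_PiE)
  have Tpos: "real (n_types P) > 0" using P by (simp add: principal_agent_def)
  have \<tau>A: "\<alpha> \<in> A (\<tau> \<alpha>)" and \<tau>g: "linear_profit P \<alpha> = g (\<tau> \<alpha>) \<alpha>" and \<tau>S: "\<tau> \<alpha> \<in> S"
    if "\<alpha> \<in> {0..1}" for \<alpha>
  proof -
    show 1: "\<alpha> \<in> A (\<tau> \<alpha>)"
      using that chosen_action_best_response(1)[OF P] by (auto simp: A_def \<tau>_def)
    show "linear_profit P \<alpha> = g (\<tau> \<alpha>) \<alpha>"
      by (simp add: linear_profit_def g_def \<tau>_def expect_type_def profit_def x_def)
    have "chosen_action P t (x \<alpha>) \<in> actions P" for t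
      using chosen_action_best_response(1)[OF P, of t "x \<alpha>"]
      by (simp add: best_responses_def is_arg_max_def)
    then have "\<tau> \<alpha> \<in> types P \<rightarrow>\<^sub>E actions P"
      unfolding \<tau>_def by auto
    then show "\<tau> \<alpha> \<in> S" using 1 by (auto simp: S_def)
  qed
  have upper: "g \<sigma> \<alpha> \<le> linear_profit P \<alpha>" if "\<alpha> \<in> A \<sigma>" for \<sigma> \<alpha>
    unfolding g_def linear_profit_def expect_type_def
    using that Tpos chosen_action_best_response(2)[OF P]
    by (intro divide_right_mono sum_mono) (auto simp: A_def x_def)
  have cont: "continuous_on B (\<lambda>\<alpha>. agent_utility P t (x \<alpha>) i)" for t i B
    unfolding agent_utility_def x_def linear_contract_def by (intro continuous_intros)
  have "compact (A \<sigma>)" if "\<sigma> \<in> S" for \<sigma>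
  proof -
    have "A \<sigma> = {0..1} \<inter> (\<Inter>t\<in>types P. \<Inter>i\<in>actions P.
        {\<alpha>. agent_utility P t (x \<alpha>) i \<le> agent_utility P t (x \<alpha>) (\<sigma> t)})"
      using that by (fastforce simp: A_def S_def best_responses_def is_arg_max_linorder PiE_iff)
    then show ?thesis
      by (auto intro!: closed_INT closed_Collect_le cont compact_Int_closed)
  qed
  moreover have "continuous_on (A \<sigma>) (g \<sigma>)" for \<sigma>
    unfolding g_def expect_type_def action_profit_def x_def linear_contract_def
    using Tpos by (intro continuous_intros) auto
  ultimately have "\<exists>\<alpha>\<in>A \<sigma>. \<forall>\<beta>\<in>A \<sigma>. g \<sigma> \<beta> \<le> g \<sigma> \<alpha>" if "\<sigma> \<in> S" for \<sigma>
    using that by (intro continuous_attains_sup) (auto simp: S_def)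
  then obtain a where a: "\<And>\<sigma>. \<sigma> \<in> S \<Longrightarrow> a \<sigma> \<in> A \<sigma>"
      "\<And>\<sigma> \<beta>. \<sigma> \<in> S \<Longrightarrow> \<beta> \<in> A \<sigma> \<Longrightarrow> g \<sigma> \<beta> \<le> g \<sigma> (a \<sigma>)"
    by metis
  have "S \<noteq> {}" using \<tau>S[of 0] by auto
  then obtain s where s: "s \<in> S" "\<And>\<sigma>. \<sigma> \<in> S \<Longrightarrow> g \<sigma> (a \<sigma>) \<le> g s (a s)"
    using finite_has_arg_max[OF finS, of "\<lambda>\<sigma>. g \<sigma> (a \<sigma>)"] unfolding is_arg_max_linorder by blast
  have max: "linear_profit P \<beta> \<le> linear_profit P (a s)" if "\<beta> \<in> {0..1}" for \<beta>
    using \<tau>g[OF that] a(2)[OF \<tau>S[OF that] \<tau>A[OF that]] s(2)[OF \<tau>S[OF that]] upper[OF a(1)[OF s(1)]]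
    by linarith
  have as: "a s \<in> {0..1}" using a(1)[OF s(1)] by (auto simp: A_def)
  have "opt_linear P = linear_profit P (a s)"
    unfolding opt_linear_def by (rule cSup_eq_maximum) (use as max in auto)
  then show ?thesis using as max by auto
qed

end

theory Submission
  imports Defs
begin

text \<open>
  (1) Let \<open>u\<^sub>t(\<alpha>)\<close> be the utility of type \<open>t\<close> under the contract \<open>\<alpha> r\<close>. It is convex with slope the
  reward of the action played, so by telescoping along \<open>\<alpha>\<^sub>k = 1 - 2\<^sup>-\<^sup>k\<close> the welfare \<open>u\<^sub>t(1)\<close> is at
  most the sum over \<open>k\<close> of the profits at \<open>\<alpha>\<^sub>k\<close>. Rewards that are large compared with the cost
  of the action are accounted for by the profit at \<open>\<alpha> = 1/2\<close>; otherwise reward and cost are comparable. For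
  a fixed action \<open>i\<close> all types have the same cost \<open>c\<^sub>i\<close>, so the first \<open>k\<close> at which some type plays \<open>i\<close>
  has \<open>2\<^sup>-\<^sup>k c\<^sub>i \<le> T \<cdot> OptLinear\<close>. After \<open>log T\<close> further steps even all \<open>T\<close> types together contribute a
  geometrically decaying amount, so each action accounts for \<open>O(log T)\<close> times the optimal profit.

  (2) Costs grow by factors of \<open>T\<close>, and the values of \<open>1 - \<alpha>\<close> at which the types switch to a given
  action form an equal-revenue distribution. The scales of different actions do not interact, so each
  action contributes a harmonic sum to the welfare while the profit stays bounded.
\<close>

section \<open>Agent responses to linear contracts\<close>

lemma linear_contract_utility:
  "agent_utility P t (linear_contract P \<alpha>) i = \<alpha> * expected_reward P t i - cost P i"
  by (simp add: agent_utility_def linear_contract_def expected_reward_def sum_distrib_left mult_ac)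

lemma linear_contract_action_profit:
  "action_profit P t (linear_contract P \<alpha>) i = (1 - \<alpha>) * expected_reward P t i"
  by (simp add: action_profit_def linear_contract_def expected_reward_def sum_distrib_left
      algebra_simps sum_subtractf)

definition linear_response :: "pa_problem \<Rightarrow> nat \<Rightarrow> real \<Rightarrow> nat" where
  "linear_response P t \<alpha> = chosen_action P t (linear_contract P \<alpha>)"

definition response_reward :: "pa_problem \<Rightarrow> nat \<Rightarrow> real \<Rightarrow> real" where
  "response_reward P t \<alpha> = expected_reward P t (linear_response P t \<alpha>)"

definition response_utility :: "pa_problem \<Rightarrow> nat \<Rightarrow> real \<Rightarrow> real" where
  "response_utility P t \<alpha> = \<alpha> * response_reward P t \<alpha> - cost P (linear_response P t \<alpha>)"

lemma linear_profit_eq: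
  "linear_profit P \<alpha> = (\<Sum>t\<in>types P. (1 - \<alpha>) * response_reward P t \<alpha>) / real (n_types P)"
  by (simp add: linear_profit_def expect_type_def profit_def linear_contract_action_profit
      response_reward_def linear_response_def)

context
  fixes P :: pa_problem
  assumes P: "principal_agent P"
begin

lemma linear_response_in_actions: "linear_response P t \<alpha> \<in> actions P"
  using chosen_action_best_response(1)[OF P, of t "linear_contract P \<alpha>"]
  by (simp add: best_responses_def is_arg_max_def linear_response_def)

lemma response_utility_ge:
  assumes "i \<in> actions P"
  shows "\<alpha> * expected_reward P t i - cost P i \<le> response_utility P t \<alpha>"
  using chosen_action_best_response(1)[OF P, of t "linear_contract P \<alpha>"] assms
  by (simp add: best_responses_def is_arg_max_linorder linear_response_def response_utility_def
      response_reward_def linear_contract_utility)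

lemma expected_reward_nonneg:
  assumes "t \<in> types P" "i \<in> actions P"
  shows "expected_reward P t i \<ge> 0"
  using P assms unfolding expected_reward_def principal_agent_def
  by (intro sum_nonneg mult_nonneg_nonneg) auto

lemma response_reward_nonneg: "t \<in> types P \<Longrightarrow> response_reward P t \<alpha> \<ge> 0"
  unfolding response_reward_def by (intro expected_reward_nonneg linear_response_in_actions)

lemma response_cost_nonneg: "cost P (linear_response P t \<alpha>) \<ge> 0"
  using P linear_response_in_actions by (simp add: principal_agent_def)

lemma response_utility_nonneg:
  assumes "t \<in> types P" "\<alpha> \<ge> 0"
  shows "response_utility P t \<alpha> \<ge> 0"
proof -
  have 1: "1 \<in> actions P" "cost P 1 = 0" using P by (auto simp: principal_agent_def)
  have "\<alpha> * expected_reward P t 1 \<ge> 0"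
    using assms 1 by (intro mult_nonneg_nonneg expected_reward_nonneg) auto
  then show ?thesis using response_utility_ge[OF 1(1), of \<alpha> t] 1(2) by linarith
qed

text \<open>The action played at \<open>b\<close> is also available at \<open>a\<close>, where its
  utility differs by exactly \<open>b - a\<close> times its reward: the subgradient inequality at
  \<open>b\<close>.\<close>

lemma response_utility_diff_le:
  "response_utility P t b - response_utility P t a \<le> (b - a) * response_reward P t b"
  using response_utility_ge[OF linear_response_in_actions[of t b], of a t]
  unfolding response_utility_def response_reward_def[of P t b] by (simp add: algebra_simps)

lemma max_welfare_eq_response_utility:
  "(MAX i\<in>actions P. expected_reward P t i - cost P i) = response_utility P t 1"
proof (rule Max_eqI)
  show "response_utility P t 1 \<in> (\<lambda>i. expected_reward P t i - cost P i) ` actions P"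
    using linear_response_in_actions[of t 1]
    by (auto simp: response_utility_def response_reward_def)
qed (use response_utility_ge[of _ 1 t] in auto)

text \<open>The step ending at \<open>1 - 1 / 2 ^ k\<close> has length \<open>1 / 2 ^ k\<close>,
  which is also the share the principal keeps there, so each summand is the profit from type
  \<open>t\<close> at that contract.\<close>

lemma dyadic_response_utility_le:
  "response_utility P t (1 - 1 / 2 ^ K) \<le> (\<Sum>k=1..K. response_reward P t (1 - 1 / 2 ^ k) / 2 ^ k)"
proof (induction K)
  case 0
  then show ?case using response_cost_nonneg[of t 0] by (simp add: response_utility_def)
next
  case (Suc K)
  have "response_utility P t (1 - 1 / 2 ^ Suc K) - response_utility P t (1 - 1 / 2 ^ K)
      \<le> response_reward P t (1 - 1 / 2 ^ Suc K) / 2 ^ Suc K"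
    using response_utility_diff_le[of t "1 - 1 / 2 ^ Suc K" "1 - 1 / 2 ^ K"] by simp
  with Suc show ?case by simp
qed

text \<open>If an action's reward exceeds four times its cost, it is already attractive to the agent at
  \<open>\<alpha> = 1 / 2\<close>, so the response there has a comparable reward.\<close>

lemma response_reward_le_cost_or_half:
  assumes "t \<in> types P"
  shows "response_reward P t \<alpha> \<le>
    4 * cost P (linear_response P t \<alpha>) + 2 * response_reward P t (1 / 2)"
  using response_utility_ge[OF linear_response_in_actions[of t \<alpha>], of "1/2" t]
    response_cost_nonneg[of t \<alpha>] response_cost_nonneg[of t "1/2"]
    response_reward_nonneg[OF assms, of "1/2"]
  unfolding response_utility_def response_reward_def by argo

end

section \<open>Bounding welfare by the optimal linear profit\<close>

lemma sum_half_powers_le: "(\<Sum>k=1..K. 1 / 2 ^ k :: real) \<le> 1"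
proof -
  have "(\<Sum>k=1..K. 1 / 2 ^ k :: real) = 1 - 1 / 2 ^ K"
    by (induction K) (auto simp: field_simps)
  then show ?thesis by simp
qed

text \<open>The terms can be nonpositive, then bounded by \<open>M\<close> for \<open>L\<close> steps, and decay geometrically
  from there on.\<close>

lemma sum_truncated_dyadic_le:
  fixes d :: "nat \<Rightarrow> real"
  assumes M: "M \<ge> 0" and c: "c \<ge> 0" and TL: "T \<le> 2 ^ L"
    and dM: "\<And>k. d k \<le> M" and dT: "\<And>k. d k \<le> c * T / 2 ^ k"
    and d0: "\<And>k. c / 2 ^ k > M \<Longrightarrow> d k \<le> 0"
  shows "(\<Sum>k=1..K. d k) \<le> M * (real L + 2)"
proof (cases "\<exists>k. c / 2 ^ k \<le> M")
  case False
  then have "(\<Sum>k=1..K. d k) \<le> 0" by (intro sum_nonpos d0) (auto simp: not_le)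
  also have "0 \<le> M * (real L + 2)" using M by simp
  finally show ?thesis .
next
  case True
  define k0 where "k0 = (LEAST k. c / 2 ^ k \<le> M)"
  have k0: "c / 2 ^ k0 \<le> M" unfolding k0_def using True by (rule LeastI_ex)
  have before: "d k \<le> 0" if "k < k0" for k
    using not_less_Least[of k "\<lambda>k. c / 2 ^ k \<le> M"] that d0[of k] unfolding k0_def by auto
  \<comment> \<open>\<open>L\<close> halvings beyond \<open>k0\<close> absorb the factor
    \<open>T\<close>.\<close>
  have after: "d (k0 + L + j) \<le> M * (1 / 2 ^ j)" for j
  proof -
    have "d (k0 + L + j) \<le> c * T / 2 ^ (k0 + L + j)" by (rule dT)
    also have "\<dots> = (c / 2 ^ k0) * (T / 2 ^ L) * (1 / 2 ^ j)" by (simp add: power_add)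
    also have "\<dots> \<le> (c / 2 ^ k0) * 1 * (1 / 2 ^ j)"
      using TL c by (intro mult_right_mono mult_left_mono) (auto simp: divide_le_eq)
    also have "\<dots> \<le> M * (1 / 2 ^ j)" using mult_right_mono[OF k0, of "1 / 2 ^ j"] by simp
    finally show ?thesis .
  qed
  \<comment> \<open>The second window is long enough that, with the first and the indices below
    \<open>k0\<close>, it covers \<open>{1..K}\<close>.\<close>
  have "(\<Sum>k=1..K. d k) \<le> (\<Sum>k=1..K. (if k \<in> {k0..<k0+L} then M else 0) +
      (if k \<in> {k0+L..k0+L+K} then M * (1 / 2 ^ (k - (k0 + L))) else 0))"
  proof (rule sum_mono)
    fix k assume "k \<in> {1..K}"
    then consider "k < k0" | "k \<in> {k0..<k0+L}" | "k0 + L \<le> k" "k \<le> k0+L+K" by fastforce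
    then show "d k \<le> (if k \<in> {k0..<k0+L} then M else 0) +
      (if k \<in> {k0+L..k0+L+K} then M * (1 / 2 ^ (k - (k0 + L))) else 0)"
      using before[of k] dM[of k] after[of "k - (k0 + L)"] M by cases auto
  qed
  also have "\<dots> \<le> (\<Sum>k\<in>{k0..<k0+L}. M) + (\<Sum>k\<in>{k0+L..k0+L+K}. M * (1 / 2 ^ (k - (k0 + L))))"
    unfolding sum.distrib sum.inter_restrict[symmetric, OF finite_atLeastAtMost]
    using M by (intro add_mono sum_mono2) auto
  also have "(\<Sum>k\<in>{k0+L..k0+L+K}. M * (1 / 2 ^ (k - (k0 + L)))) = (\<Sum>j\<in>{0..K}. M * (1 / 2 ^ j))"
    by (rule sum.reindex_bij_witness[where i="\<lambda>j. j + (k0 + L)" and j="\<lambda>k. k - (k0 + L)"]) auto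
  also have "\<dots> = M * (1 + (\<Sum>j=1..K. 1 / 2 ^ j))"
    unfolding sum_distrib_left[symmetric] by (simp add: sum.atLeast_Suc_atMost)
  also have "\<dots> \<le> M * 2" using sum_half_powers_le[of K] M by (intro mult_left_mono) auto
  finally show ?thesis by (simp add: algebra_simps)
qed

lemma response_profit_le_opt_linear:
  assumes P: "principal_agent P" and \<alpha>: "\<alpha> \<in> {0..1}"
  shows "(\<Sum>t\<in>types P. (1 - \<alpha>) * response_reward P t \<alpha>) \<le> real (n_types P) * opt_linear P"
proof -
  have "linear_profit P \<alpha> \<le> opt_linear P"
    using opt_linear_attained[OF P] \<alpha> by metis
  moreover have "real (n_types P) > 0" using P by (simp add: principal_agent_def)
  ultimately show ?thesis unfolding linear_profit_eq by (simp add: field_simps)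
qed

text \<open>All types share the cost of \<open>i\<close>, so the \<open>k\<close>-th term counts the
  types playing \<open>i\<close> in units of \<open>cost P i / 2 ^ k\<close>. The count is at most
  \<open>n_types P\<close>, and the term is at most the total profit; a single unit exceeding that
  profit therefore means that nobody plays \<open>i\<close>.\<close>

lemma sum_cost_action_le:
  assumes P: "principal_agent P" and L: "real (n_types P) \<le> 2 ^ L" and i: "i \<in> actions P"
  shows "(\<Sum>k=1..K. \<Sum>t\<in>types P.
      if linear_response P t (1 - 1 / 2 ^ k) = i then cost P i / 2 ^ k else 0)
    \<le> real (n_types P) * opt_linear P * (real L + 2)"
proof (rule sum_truncated_dyadic_le[where c="cost P i" and T="real (n_types P)"])
  let ?M = "real (n_types P) * opt_linear P"
  let ?a = "\<lambda>t k. linear_response P t (1 - 1 / 2 ^ k)"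
  let ?d = "\<lambda>k. \<Sum>t\<in>types P. if ?a t k = i then cost P i / 2 ^ k else 0"
  show c: "cost P i \<ge> 0" using P i by (simp add: principal_agent_def)
  show dM: "?d k \<le> ?M" for k
  proof -
    have "?d k \<le> (\<Sum>t\<in>types P. (1 - (1 - 1 / 2 ^ k)) * response_reward P t (1 - 1 / 2 ^ k))"
    proof (rule sum_mono)
      fix t assume t: "t \<in> types P"
      let ?\<alpha> = "1 - 1 / 2 ^ k :: real"
      \<comment> \<open>The free action guarantees utility 0, so the share paid to the agent covers
        the cost of the chosen action.\<close>
      have "?\<alpha> * response_reward P t ?\<alpha> \<ge> cost P (?a t k)"
        using response_utility_nonneg[OF P t, of ?\<alpha>] by (simp add: response_utility_def)
      moreover have "?\<alpha> * response_reward P t ?\<alpha> \<le> 1 * response_reward P t ?\<alpha>"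
        by (intro mult_right_mono response_reward_nonneg[OF P t]) auto
      ultimately have "cost P (?a t k) \<le> response_reward P t ?\<alpha>" by linarith
      then show "(if ?a t k = i then cost P i / 2 ^ k else 0) \<le> (1 - ?\<alpha>) * response_reward P t ?\<alpha>"
        using response_reward_nonneg[OF P t, of ?\<alpha>] by (auto intro: divide_right_mono)
    qed
    also have "\<dots> \<le> ?M" by (rule response_profit_le_opt_linear[OF P]) auto
    finally show ?thesis .
  qed
  have "0 \<le> ?d 0" using c by (intro sum_nonneg) auto
  then show "?M \<ge> 0" using dM[of 0] by linarith
  show "?d k \<le> cost P i * real (n_types P) / 2 ^ k" for k
    using sum_bounded_above[of "types P" "\<lambda>t. if ?a t k = i then cost P i / 2 ^ k else 0"
        "cost P i / 2 ^ k"] c by (auto simp: mult_ac)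
  show "?d k \<le> 0" if big: "cost P i / 2 ^ k > ?M" for k
  proof -
    have "?a t k \<noteq> i" if t: "t \<in> types P" for t
    proof
      assume "?a t k = i"
      then have "cost P i / 2 ^ k \<le> ?d k"
        using member_le_sum[of t "types P" "\<lambda>t. if ?a t k = i then cost P i / 2 ^ k else 0"] c t
        by auto
      with dM[of k] big show False by linarith
    qed
    then show ?thesis by (intro sum_nonpos) auto
  qed
qed (use L in auto)

text \<open>Each dyadic reward splits into 4 times a cost plus twice a reward at share 1/2. Grouping
  the costs by action gives the factor \<open>n_actions P\<close>; the rewards at share 1/2, with
  geometric weights, give the final 4.\<close>

lemma sum_response_utility_le:
  assumes P: "principal_agent P" and L: "real (n_types P) \<le> 2 ^ L"
  shows "(\<Sum>t\<in>types P. response_utility P t 1)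
    \<le> real (n_types P) * opt_linear P * (4 * real (n_actions P) * (real L + 2) + 4)"
proof -
  let ?M = "real (n_types P) * opt_linear P"
  let ?\<alpha> = "\<lambda>k. 1 - 1 / 2 ^ k :: real"
  let ?a = "\<lambda>t k. linear_response P t (?\<alpha> k)"
  let ?B = "?M * (4 * real (n_actions P) * (real L + 2) + 4)"
  \<comment> \<open>\<open>S / 2 ^ K\<close> bounds the leftover step from
    \<open>1 - 1 / 2 ^ K\<close> to 1 and vanishes as \<open>K\<close> grows.\<close>
  define S where "S = (\<Sum>t\<in>types P. response_reward P t 1)"
  have half: "(\<Sum>t\<in>types P. response_reward P t (1/2)) \<le> 2 * ?M"
    using response_profit_le_opt_linear[OF P, of "1/2"] by (simp add: sum_divide_distrib[symmetric])
  have half0: "(\<Sum>t\<in>types P. response_reward P t (1/2)) \<ge> 0"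
    by (intro sum_nonneg response_reward_nonneg[OF P])
  have costs: "(\<Sum>k=1..K. \<Sum>t\<in>types P. cost P (?a t k) / 2 ^ k)
      \<le> real (n_actions P) * (?M * (real L + 2))" for K
  proof -
    have "(\<Sum>k=1..K. \<Sum>t\<in>types P. cost P (?a t k) / 2 ^ k)
      = (\<Sum>k=1..K. \<Sum>t\<in>types P. \<Sum>i\<in>actions P. if ?a t k = i then cost P i / 2 ^ k else 0)"
      using linear_response_in_actions[OF P] by (intro sum.cong) (auto simp: sum.delta')
    also have "\<dots> = (\<Sum>i\<in>actions P. \<Sum>k=1..K. \<Sum>t\<in>types P.
        if ?a t k = i then cost P i / 2 ^ k else 0)"
      by (subst (2) sum.swap, subst sum.swap) simp
    also have "\<dots> \<le> (\<Sum>i\<in>actions P. ?M * (real L + 2))"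
      by (intro sum_mono sum_cost_action_le[OF P L])
    finally show ?thesis by simp
  qed
  have main: "(\<Sum>t\<in>types P. response_utility P t 1) \<le> ?B + S * (1 / 2 ^ K)" for K
  proof -
    have "(\<Sum>t\<in>types P. response_utility P t 1)
      \<le> (\<Sum>t\<in>types P. (\<Sum>k=1..K. response_reward P t (?\<alpha> k) / 2 ^ k) + response_reward P t 1 / 2 ^ K)"
      using dyadic_response_utility_le[OF P, of _ K] response_utility_diff_le[OF P, of _ 1 "?\<alpha> K"]
      by (intro sum_mono) (smt (verit, best) mult.commute times_divide_eq_right mult_cancel_left1)
    also have "\<dots> = (\<Sum>k=1..K. \<Sum>t\<in>types P. response_reward P t (?\<alpha> k) / 2 ^ k) + S * (1 / 2 ^ K)"
      unfolding sum.distrib S_def by (subst sum.swap) (simp add: sum_divide_distrib)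
    also have "(\<Sum>k=1..K. \<Sum>t\<in>types P. response_reward P t (?\<alpha> k) / 2 ^ k)
      \<le> (\<Sum>k=1..K. \<Sum>t\<in>types P. 4 * (cost P (?a t k) / 2 ^ k) +
          2 * response_reward P t (1/2) * (1 / 2 ^ k))"
    proof (intro sum_mono)
      fix k t assume "t \<in> types P"
      from divide_right_mono[OF response_reward_le_cost_or_half[OF P this, of "?\<alpha> k"], of "2 ^ k"]
      show "response_reward P t (?\<alpha> k) / 2 ^ k
        \<le> 4 * (cost P (?a t k) / 2 ^ k) + 2 * response_reward P t (1/2) * (1 / 2 ^ k)"
        by (simp add: add_divide_distrib)
    qed
    also have "\<dots> = 4 * (\<Sum>k=1..K. \<Sum>t\<in>types P. cost P (?a t k) / 2 ^ k) +
        2 * (\<Sum>t\<in>types P. response_reward P t (1/2)) * (\<Sum>k=1..K. 1 / 2 ^ k)"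
      unfolding sum.distrib sum_distrib_left sum_distrib_right ..
    also have "\<dots> \<le> 4 * (real (n_actions P) * (?M * (real L + 2))) +
        2 * (\<Sum>t\<in>types P. response_reward P t (1/2)) * 1"
      using costs[of K] half0 sum_half_powers_le[of K] by (intro add_mono mult_left_mono) auto
    also have "\<dots> \<le> ?B" using half by (simp add: algebra_simps)
    finally show ?thesis by simp
  qed
  have "(\<lambda>K. ?B + S * (1 / 2) ^ K) \<longlonglongrightarrow> ?B + S * 0"
    by (intro tendsto_intros LIMSEQ_power_zero) auto
  then have "(\<lambda>K. ?B + S * (1 / 2 ^ K)) \<longlonglongrightarrow> ?B" by (simp add: power_one_over)
  then show ?thesis by (rule LIMSEQ_le_const) (use main in blast)
qed

lemma ln_ge_half:
  assumes "(T::real) \<ge> 2" shows "ln T \<ge> 1/2"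
proof -
  have "ln (1/2 :: real) \<le> 1/2 - 1" by (rule ln_le_minus_one) simp
  then have "ln (2::real) \<ge> 1/2" by (simp add: ln_div)
  also have "ln 2 \<le> ln T" using assms by simp
  finally show ?thesis .
qed

lemma welfare_le_opt_linear:
  assumes P: "principal_agent P" and T: "n_types P \<ge> 2"
  shows "welfare P \<le> opt_linear P * (44 * real (n_actions P) * ln (real (n_types P)))"
proof -
  let ?T = "real (n_types P)" and ?n = "real (n_actions P)"
  have T2: "?T \<ge> 2" using T by simp
  have n1: "?n \<ge> 1" using P by (simp add: principal_agent_def)
  define L where "L = nat \<lceil>log 2 ?T\<rceil>"
  have log0: "log 2 ?T \<ge> 0" using T2 by simp
  have "?T = 2 powr log 2 ?T" using T2 by simp
  also have "\<dots> \<le> 2 powr real L" unfolding L_def using log0 by (intro powr_mono) auto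
  finally have TL: "?T \<le> 2 ^ L" by (simp add: powr_realpow)
  have "real L \<le> log 2 ?T + 1" unfolding L_def using log0 by linarith
  also have "log 2 ?T \<le> 2 * ln ?T"
  proof -
    have "ln ?T * 1 \<le> ln ?T * (2 * ln 2)"
      using ln_ge_half[of 2] T2 by (intro mult_left_mono) auto
    then show ?thesis by (simp add: log_def field_simps)
  qed
  finally have Ll: "real L \<le> 2 * ln ?T + 1" by simp
  \<comment> \<open>At \<alpha> = 1 the principal keeps nothing, so the profit there is 0.\<close>
  have M0: "?T * opt_linear P \<ge> 0"
    using response_profit_le_opt_linear[OF P, of 1] by simp
  have "?T * welfare P = (\<Sum>t\<in>types P. response_utility P t 1)"
    using T unfolding welfare_def expect_type_def max_welfare_eq_response_utility[OF P] by simp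
  also have "\<dots> \<le> ?T * opt_linear P * (4 * ?n * (real L + 2) + 4)"
    by (rule sum_response_utility_le[OF P TL])
  also have "\<dots> \<le> ?T * opt_linear P * (44 * ?n * ln ?T)"
  proof (rule mult_left_mono[OF _ M0])
    \<comment> \<open>\<open>L\<close> is at most \<open>2 * ln ?T + 1\<close> and
      \<open>ln ?T\<close> at least 1/2, so \<open>4 * L + 12\<close> is at most
      \<open>40 * ln ?T\<close>; 44 leaves slack.\<close>
    have "?n * (4 * real L + 12) \<le> ?n * (44 * ln ?T)"
      using Ll ln_ge_half[OF T2] n1 by (intro mult_left_mono) auto
    then show "4 * ?n * (real L + 2) + 4 \<le> 44 * ?n * ln ?T"
      using n1 by (simp add: algebra_simps)
  qed
  finally have "?T * welfare P \<le> ?T * (opt_linear P * (44 * ?n * ln ?T))" by simp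
  then show ?thesis using T2 by simp
qed

section \<open>The hard instances\<close>

definition hard_cost :: "nat \<Rightarrow> nat \<Rightarrow> real" where
  "hard_cost T l = (if l \<le> 1 then 0 else real T ^ (l - 2))"

text \<open>Type \<open>t\<close> switches from action \<open>l - 1\<close> to action \<open>l\<close> at \<open>\<alpha> = 1 - hard_gap T t l\<close>. For fixed \<open>l\<close>
  the gaps are proportional to \<open>1 / t\<close>, an equal-revenue distribution.\<close>

definition hard_gap :: "nat \<Rightarrow> nat \<Rightarrow> nat \<Rightarrow> real" where
  "hard_gap T t l = 1 / (2 * real t * real T ^ (l - 2))"

text \<open>Each increment makes type \<open>t\<close> indifferent between \<open>l - 1\<close> and
  \<open>l\<close> at \<alpha> = \<open>1 - hard_gap T t l\<close>.\<close>

definition hard_reward :: "nat \<Rightarrow> nat \<Rightarrow> nat \<Rightarrow> real" where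
  "hard_reward T t i =
     (\<Sum>l=2..i. (hard_cost T l - hard_cost T (l - 1)) / (1 - hard_gap T t l))"

text \<open>Two outcomes realise the prescribed expected rewards: the better one pays
  \<open>M\<close> with probability reward over \<open>M\<close>. \<open>M\<close> is twice the
  largest cost, which bounds every reward.\<close>

definition hard_problem :: "nat \<Rightarrow> nat \<Rightarrow> pa_problem" where
  "hard_problem n T = (let M = 2 * real T ^ (n - 2) in
     \<lparr>n_actions = n, n_outcomes = 2, n_types = T, cost = hard_cost T,
      outcome_prob = (\<lambda>t i j. if j = 2 then hard_reward T t i / M else 1 - hard_reward T t i / M),
      reward = (\<lambda>j. if j = 2 then M else 0)\<rparr>)"

lemma hard_cost_nonneg: "hard_cost T l \<ge> 0"
  by (simp add: hard_cost_def)

lemma hard_cost_mono: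
  assumes "T \<ge> 2" "i \<le> j"
  shows "hard_cost T i \<le> hard_cost T j"
  using assms by (auto simp: hard_cost_def intro!: power_increasing)

lemma hard_cost_step:
  assumes T: "T \<ge> 2" and l: "l \<ge> 2"
  shows "hard_cost T l - hard_cost T (l - 1) \<ge> real T ^ (l - 2) / 2"
proof (cases "l = 2")
  case False
  then obtain k where "l = k + 3" using l by (intro that[of "l - 3"]) auto
  moreover have "2 * real T ^ k \<le> real T * real T ^ k" using T by (intro mult_right_mono) auto
  ultimately show ?thesis by (simp add: hard_cost_def)
qed (simp add: hard_cost_def)

text \<open>The bound 1/2 controls the divisors in \<open>hard_reward\<close> and so keeps rewards
  within twice the costs.\<close>

lemma hard_gap_bounds:
  assumes "T \<ge> 2" "t \<ge> 1"
  shows "hard_gap T t l > 0" "hard_gap T t l \<le> 1 / 2"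
proof -
  have "1 * 1 \<le> real t * real T ^ (l - 2)"
    using assms by (intro mult_mono one_le_power) auto
  then show "hard_gap T t l > 0" "hard_gap T t l \<le> 1 / 2"
    by (auto simp: hard_gap_def divide_simps)
qed

lemma sum_hard_cost_steps: "i \<ge> 1 \<Longrightarrow> (\<Sum>l=2..i. hard_cost T l - hard_cost T (l - 1)) = hard_cost T i"
  by (induction i rule: dec_induct) (auto simp: hard_cost_def sum.cl_ivl_Suc)

lemma hard_reward_bounds:
  assumes T: "T \<ge> 2" and t: "t \<ge> 1" and i: "i \<ge> 1"
  shows "0 \<le> hard_reward T t i" "hard_reward T t i \<le> 2 * hard_cost T i"
proof -
  have step: "hard_cost T l - hard_cost T (l - 1) \<ge> 0" for l
    using hard_cost_mono[OF T, of "l - 1" l] by simp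
  have gap: "1 - hard_gap T t l \<ge> 1 / 2" for l using hard_gap_bounds[OF T t, of l] by simp
  show "0 \<le> hard_reward T t i"
    unfolding hard_reward_def
    by (intro sum_nonneg divide_nonneg_nonneg step order_trans[OF _ gap]) auto
  have "hard_reward T t i \<le> (\<Sum>l=2..i. 2 * (hard_cost T l - hard_cost T (l - 1)))"
    unfolding hard_reward_def
  proof (rule sum_mono)
    fix l
    have "(hard_cost T l - hard_cost T (l - 1)) * 1
        \<le> (hard_cost T l - hard_cost T (l - 1)) * (2 * (1 - hard_gap T t l))"
      using step gap[of l] by (intro mult_left_mono) auto
    then show "(hard_cost T l - hard_cost T (l - 1)) / (1 - hard_gap T t l)
        \<le> 2 * (hard_cost T l - hard_cost T (l - 1))"
      using gap[of l] by (subst pos_divide_le_eq) (simp_all add: algebra_simps)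
  qed
  also have "\<dots> = 2 * hard_cost T i"
    unfolding sum_distrib_left[symmetric] sum_hard_cost_steps[OF i] ..
  finally show "hard_reward T t i \<le> 2 * hard_cost T i" .
qed

lemma hard_problem_simps [simp]:
  "n_actions (hard_problem n T) = n" "n_outcomes (hard_problem n T) = 2"
  "n_types (hard_problem n T) = T" "cost (hard_problem n T) = hard_cost T"
  by (simp_all add: hard_problem_def Let_def)

lemma principal_agent_hard_problem:
  assumes n: "n \<ge> 2" and T: "T \<ge> 2"
  shows "principal_agent (hard_problem n T)"
proof -
  have two: "{1..2::nat} = {1, 2}" by auto
  let ?M = "2 * real T ^ (n - 2)"
  have le: "hard_reward T t i \<le> ?M" if "t \<ge> 1" "i \<in> {1..n}" for t i
    using hard_reward_bounds(2)[OF T, of t i] hard_cost_mono[OF T, of i n] that n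
    by (auto simp: hard_cost_def)
  have "hard_reward T t i / ?M \<in> {0..1}" if "t \<ge> 1" "i \<in> {1..n}" for t i
    using hard_reward_bounds(1)[OF T, of t i] le[OF that] that T by (auto simp: divide_le_eq)
  moreover have "mono_on {1..n} (hard_cost T)"
    by (intro mono_onI hard_cost_mono[OF T])
  ultimately show ?thesis
    using n T unfolding principal_agent_def hard_problem_simps two
    by (auto simp: hard_problem_def Let_def mono_on_def hard_cost_nonneg) (auto simp: hard_cost_def)
qed

lemma expected_reward_hard_problem:
  assumes "T \<ge> 2"
  shows "expected_reward (hard_problem n T) t i = hard_reward T t i"
proof -
  have two: "{1..2::nat} = {1, 2}" by auto
  show ?thesis
    using assms unfolding expected_reward_def hard_problem_simps two
    by (simp add: hard_problem_def Let_def)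
qed

text \<open>Compare \<open>a\<close> with its neighbour \<open>a - 1\<close>: the share \<alpha> of
  the extra reward must cover the extra cost.\<close>

lemma hard_problem_response_gap:
  assumes n: "n \<ge> 2" and T: "T \<ge> 2" and t: "t \<ge> 1"
    and a: "linear_response (hard_problem n T) t \<alpha> = a" "a \<ge> 2"
  shows "1 - \<alpha> \<le> hard_gap T t a"
proof -
  let ?D = "hard_cost T a - hard_cost T (a - 1)"
  have "a \<in> {1..n}"
    using linear_response_in_actions[OF principal_agent_hard_problem[OF n T], of t \<alpha>] a by simp
  then have "a - 1 \<in> {1..n}" using a(2) by auto
  then have "\<alpha> * hard_reward T t (a - 1) - hard_cost T (a - 1)
      \<le> \<alpha> * hard_reward T t a - hard_cost T a"
    using response_utility_ge[OF principal_agent_hard_problem[OF n T], of "a - 1" \<alpha> t] a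
    by (simp add: response_utility_def response_reward_def expected_reward_hard_problem[OF T])
  moreover have "hard_reward T t a = hard_reward T t (a - 1) + ?D / (1 - hard_gap T t a)"
  proof -
    obtain b where "a = Suc b" using a(2) by (cases a) auto
    then show ?thesis using a(2) by (simp add: hard_reward_def)
  qed
  ultimately have "?D \<le> \<alpha> * (?D / (1 - hard_gap T t a))" by (simp add: algebra_simps)
  then have "?D * (1 - hard_gap T t a) \<le> ?D * \<alpha>"
    using hard_gap_bounds[OF T t, of a] by (simp add: field_simps)
  moreover have "?D > 0" using hard_cost_step[OF T a(2)] T by (smt (verit) half_gt_zero of_nat_0_less_iff
        pos2 order_less_le_trans zero_less_power)
  ultimately show ?thesis by simp
qed

text \<open>The types playing the costliest chosen action contribute at most 1 by the equal-revenue
  choice of the gaps. Every other type plays an action cheaper by a factor of \<open>T\<close>, so together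
  these also contribute at most 1.\<close>

lemma sum_hard_cost_le:
  assumes T: "T \<ge> 2" and x: "x \<ge> 0"
    and gap: "\<And>t. t \<in> {1..T} \<Longrightarrow> a t \<ge> 2 \<Longrightarrow> x \<le> hard_gap T t (a t)"
  shows "(\<Sum>t=1..T. x * (2 * hard_cost T (a t))) \<le> 2"
proof -
  define i where "i = Max (a ` {1..T})"
  have ai: "a t \<le> i" if "t \<in> {1..T}" for t using that by (simp add: i_def)
  show ?thesis
  proof (cases "i \<ge> 2")
    case False
    then have "hard_cost T (a t) = 0" if "t \<in> {1..T}" for t
      using ai[OF that] by (simp add: hard_cost_def)
    then show ?thesis by simp
  next
    case True
    let ?y = "x * (2 * hard_cost T i)"
    have y0: "?y \<ge> 0" using x hard_cost_nonneg by simp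
    define B where "B = {t\<in>{1..T}. a t = i}"
    have "i \<in> a ` {1..T}" unfolding i_def using T by (intro Max_in) auto
    then have finB: "finite B" and "B \<noteq> {}" by (auto simp: B_def)
    \<comment> \<open>At most \<open>s\<close> types play \<open>i\<close>, and the gap of type
      \<open>s\<close> is proportional to \<open>1 / s\<close>, hence \<open>s * ?y\<close> is at
      most 1.\<close>
    define s where "s = Max B"
    have s: "s \<in> {1..T}" "a s = i" using Max_in[OF finB \<open>B \<noteq> {}\<close>] by (auto simp: s_def B_def)
    have "B \<subseteq> {1..T}" by (auto simp: B_def)
    have "B \<subseteq> {1..s}" using finB by (auto simp: s_def) (auto simp: B_def)
    then have cardB: "card B \<le> s" using card_mono[of "{1..s}" B] by simp
    have "x \<le> hard_gap T s i" using gap[OF s(1)] s(2) True by simp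
    then have ys: "real s * ?y \<le> 1"
      using s(1) T True by (simp add: hard_gap_def hard_cost_def field_simps)
    have "1 * ?y \<le> real s * ?y" using s(1) y0 by (intro mult_right_mono) auto
    with ys have y1: "?y \<le> 1" by linarith
    \<comment> \<open>\<open>?y / T\<close> bounds each type outside \<open>B\<close>; granting it
      to all \<open>T\<close> types adds \<open>?y\<close> in total.\<close>
    have "(\<Sum>t=1..T. x * (2 * hard_cost T (a t))) \<le> (\<Sum>t=1..T. (if t \<in> B then ?y else 0) + ?y / real T)"
    proof (rule sum_mono)
      fix t assume t: "t \<in> {1..T}"
      show "x * (2 * hard_cost T (a t)) \<le> (if t \<in> B then ?y else 0) + ?y / real T"
      proof (cases "t \<in> B")
        case True
        then show ?thesis using y0 T by (simp add: B_def)
      next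
        case False
        then have "a t \<le> i - 1" using ai[OF t] t by (auto simp: B_def)
        then have "hard_cost T (a t) \<le> hard_cost T (i - 1)" by (rule hard_cost_mono[OF T])
        \<comment> \<open>The case \<open>i = 2\<close> is separate because action 1 is
          free.\<close>
        also have "hard_cost T (i - 1) \<le> hard_cost T i / real T"
        proof (cases "i = 2")
          case False
          then obtain k where "i = k + 3" using \<open>i \<ge> 2\<close> by (intro that[of "i - 3"]) auto
          then show ?thesis using T by (simp add: hard_cost_def)
        qed (use T in \<open>simp add: hard_cost_def\<close>)
        finally have "x * (2 * hard_cost T (a t)) \<le> x * (2 * (hard_cost T i / real T))"
          using x by (intro mult_left_mono) auto
        then show ?thesis using False by simp
      qed
    qed
    also have "\<dots> = real (card B) * ?y + ?y"
      using T \<open>B \<subseteq> {1..T}\<close> unfolding sum.distrib sum.inter_restrict[symmetric, OF finite_atLeastAtMost]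
      by (simp add: Int_absorb1)
    also have "\<dots> \<le> real s * ?y + ?y"
      using cardB y0 by (intro add_right_mono mult_right_mono) auto
    finally show ?thesis using ys y1 by linarith
  qed
qed

lemma opt_linear_hard_problem:
  assumes n: "n \<ge> 2" and T: "T \<ge> 2"
  shows "opt_linear (hard_problem n T) \<le> 2 / real T"
proof -
  let ?P = "hard_problem n T"
  note P = principal_agent_hard_problem[OF n T]
  obtain \<alpha> where \<alpha>: "\<alpha> \<in> {0..1}" "opt_linear ?P = linear_profit ?P \<alpha>"
    using opt_linear_attained[OF P] by metis
  let ?a = "\<lambda>t. linear_response ?P t \<alpha>"
  have "(\<Sum>t=1..T. (1 - \<alpha>) * response_reward ?P t \<alpha>) \<le> (\<Sum>t=1..T. (1 - \<alpha>) * (2 * hard_cost T (?a t)))"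
    using \<alpha>(1) hard_reward_bounds(2)[OF T] linear_response_in_actions[OF P]
    by (intro sum_mono mult_left_mono)
      (auto simp: response_reward_def expected_reward_hard_problem[OF T])
  also have "\<dots> \<le> 2"
    using \<alpha>(1) hard_problem_response_gap[OF n T] by (intro sum_hard_cost_le[OF T]) auto
  finally show ?thesis
    unfolding \<alpha>(2) linear_profit_eq by (simp add: divide_right_mono)
qed

text \<open>Action \<open>n\<close> bounds the maximum from below. Each of its \<open>n - 1\<close>,
  hence at least \<open>n / 2\<close>, steps adds surplus at least \<open>1 / (4 * t)\<close>, and
  the sum of \<open>1 / t\<close> over types is harmonic.\<close>

lemma welfare_hard_problem:
  assumes n: "n \<ge> 2" and T: "T \<ge> 2"
  shows "welfare (hard_problem n T) \<ge> real n * ln (real T) / (8 * real T)"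
proof -
  have type_welfare: "(MAX i\<in>{1..n}. hard_reward T t i - hard_cost T i) \<ge> real n / 8 * inverse (real t)"
    if t: "t \<in> {1..T}" for t
  proof -
    have t1: "t \<ge> 1" using t by simp
    let ?D = "\<lambda>l. hard_cost T l - hard_cost T (l - 1)"
    have "(\<Sum>l=2..n. 1 / (4 * real t)) \<le> (\<Sum>l=2..n. ?D l / (1 - hard_gap T t l) - ?D l)"
    proof (rule sum_mono)
      fix l assume l: "l \<in> {2..n}"
      define g where "g = hard_gap T t l"
      have g: "g > 0" "g \<le> 1/2" using hard_gap_bounds[OF T t1] by (auto simp: g_def)
      have D: "?D l \<ge> real T ^ (l - 2) / 2" using hard_cost_step[OF T] l by simp
      then have D0: "?D l \<ge> 0" by (smt (verit) divide_nonneg_nonneg zero_le_power of_nat_0_le_iff)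
      \<comment> \<open>The powers of \<open>T\<close> in cost and gap cancel, so the bound is the
        same for every action.\<close>
      have "1 / (4 * real t) = real T ^ (l - 2) / 2 * g"
        using T t1 by (simp add: g_def hard_gap_def)
      also have "\<dots> \<le> ?D l * g" using D g by (intro mult_right_mono) auto
      also have "\<dots> \<le> ?D l * (1 / (1 - g) - 1)"
      proof (rule mult_left_mono[OF _ D0])
        have "(1 + g) * (1 - g) \<le> 1" by (simp add: algebra_simps)
        then have "1 + g \<le> 1 / (1 - g)" using g by (simp add: le_divide_eq)
        then show "g \<le> 1 / (1 - g) - 1" by simp
      qed
      finally show "1 / (4 * real t) \<le> ?D l / (1 - hard_gap T t l) - ?D l"
        by (simp add: g_def right_diff_distrib)
    qed
    also have "\<dots> = hard_reward T t n - hard_cost T n"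
      using n by (simp only: sum_subtractf hard_reward_def[symmetric])
        (use sum_hard_cost_steps[of n T] n in \<open>simp add: sum_subtractf\<close>)
    also have "\<dots> \<le> (MAX i\<in>{1..n}. hard_reward T t i - hard_cost T i)"
      using n by (intro Max_ge) auto
    finally have le: "real (n - 1) / (4 * real t) \<le> (MAX i\<in>{1..n}. hard_reward T t i - hard_cost T i)"
      using n by (simp add: Suc_diff_Suc numeral_2_eq_2)
    have "real n / 8 * inverse (real t) = (real n / 2) / (4 * real t)" by (simp add: field_simps)
    also have "\<dots> \<le> real (n - 1) / (4 * real t)"
      using n by (intro divide_right_mono) auto
    finally show ?thesis using le by linarith
  qed
  have "ln (real T) \<le> ln (real T + 1)" using T by simp
  also have "\<dots> \<le> harm T" by (rule ln_le_harm)
  finally have "real n / 8 * ln (real T) \<le> real n / 8 * harm T" by (intro mult_left_mono) auto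
  also have "\<dots> \<le> (\<Sum>t=1..T. MAX i\<in>{1..n}. hard_reward T t i - hard_cost T i)"
    unfolding harm_def sum_distrib_left by (intro sum_mono type_welfare) auto
  also have "\<dots> = real T * welfare (hard_problem n T)"
    using T by (simp add: welfare_def expect_type_def expected_reward_hard_problem[OF T])
  finally show ?thesis using T by (simp add: field_simps)
qed

theorem theorem3:
  shows "\<exists>C1 C2 :: real. C1 > 0 \<and> C2 > 0 \<and>
    (\<forall>P. principal_agent P \<and> n_types P \<ge> 2 \<longrightarrow>
       opt_linear P \<ge> C1 / (real (n_actions P) * ln (real (n_types P))) * welfare P) \<and>
    (\<forall>n T :: nat. n \<ge> 2 \<and> T \<ge> 2 \<longrightarrow>
       (\<exists>P. principal_agent P \<and> n_actions P = n \<and> n_types P = T \<and> welfare P > 0 \<and>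
          opt_linear P \<le> C2 / (real n * ln (real T)) * welfare P))"
\<comment> \<open>1/44 inverts the constant of \<open>welfare_le_opt_linear\<close>; 16 is the
  profit bound \<open>2 / T\<close> times the factor \<open>8 * T\<close> from the welfare
  bound.\<close>
proof (rule exI[of _ "1/44"], rule exI[of _ 16], intro conjI allI impI)
  fix P assume "principal_agent P \<and> n_types P \<ge> 2"
  then have P: "principal_agent P" and T: "n_types P \<ge> 2" by auto
  have "real (n_actions P) * ln (real (n_types P)) > 0"
    using P T by (intro mult_pos_pos ln_gt_zero) (auto simp: principal_agent_def)
  then show "opt_linear P \<ge> 1/44 / (real (n_actions P) * ln (real (n_types P))) * welfare P"
    using welfare_le_opt_linear[OF P T] by (simp add: field_simps)
next
  fix n T :: nat assume "n \<ge> 2 \<and> T \<ge> 2"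
  then have n: "n \<ge> 2" and T: "T \<ge> 2" by auto
  let ?P = "hard_problem n T" and ?q = "real n * ln (real T)"
  have q: "?q > 0" using n T by (intro mult_pos_pos ln_gt_zero) auto
  note W = welfare_hard_problem[OF n T]
  have "?q / (8 * real T) > 0" using q T by (intro divide_pos_pos) auto
  then have W0: "welfare ?P > 0" using W by linarith
  have "opt_linear ?P \<le> 2 / real T" by (rule opt_linear_hard_problem[OF n T])
  also have "\<dots> = 16 / ?q * (?q / (8 * real T))" using q T n by (simp add: field_simps)
  also have "\<dots> \<le> 16 / ?q * welfare ?P" using q W by (intro mult_left_mono) auto
  finally show "\<exists>P. principal_agent P \<and> n_actions P = n \<and> n_types P = T \<and> welfare P > 0 \<and>
          opt_linear P \<le> 16 / ?q * welfare P"
    using principal_agent_hard_problem[OF n T] W0 by (intro exI[of _ ?P]) simp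
qed simp_all

end
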